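(* Let $\epsilon\in\mathbb{R}$ with $\epsilon\neq 0$, let $a>0$, and let $y(x)=a e^{-ax}$ for $x\ge 0$. Let $T_K$ be the operator with kernel $$K(u,v,x)=1-\frac{\epsilon}{3}+\frac{2\epsilon x}{u+v}-\frac{2\epsilon x^2}{(u+v)^2}.$$ Then for all $x>0$ $$(T_Ky)(x)=\left(1-\frac{\epsilon}{3}\right)ae^{-ax}-2\epsilon x a^2\,\mathrm{Ei}(-ax)-2\epsilon x^2a^2\left[\frac{e^{-ax}}{x}+a\,\mathrm{Ei}(-ax)\right],$$ and $y$ is not a fixed point of $T_K$, i.e. $T_Ky\neq y$.
   Context: For a kernel $K(u,v,x)$ and a nonnegative integrable function $y$ on $[0,\infty)$, the operator $T_K$ is defined by $$(T_Ky)(x)=\iint_{\{u,v>0,\ u+v\ge x\}}K(u,v,x)\,\frac{y(u)y(v)}{u+v}\,du\,dv,\qquad x\ge 0.$$ The exponential integral is, for $a>0$ and $x>0$, $\mathrm{Ei}(-ax)=-\int_x^\infty \frac{e^{-at}}{t}\,dt$. *)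

theory Defs
  imports "HOL-Analysis.Analysis"
begin

definition T_domain :: "real \<Rightarrow> (real \<times> real) set" where
  "T_domain x = {(u, v). 0 < u \<and> 0 < v \<and> x \<le> u + v}"

definition T_integrand ::
  "(real \<Rightarrow> real \<Rightarrow> real \<Rightarrow> real) \<Rightarrow> (real \<Rightarrow> real) \<Rightarrow> real \<Rightarrow> real \<times> real \<Rightarrow> real" where
  "T_integrand K y x = (\<lambda>(u, v). K u v x * (y u * y v / (u + v)))"

text \<open>The Bochner integral is 0 for non-integrable functions, so \<open>T_op K y x\<close> is meaningful
  only under \<open>T_defined K y x\<close>. Functions on \<open>[0, \<infinity>)\<close> are represented by functions on all
  reals; the values of \<open>y\<close> at negative arguments are never used.\<close>

definition T_defined ::
  "(real \<Rightarrow> real \<Rightarrow> real \<Rightarrow> real) \<Rightarrow> (real \<Rightarrow> real) \<Rightarrow> real \<Rightarrow> bool" where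
  "T_defined K y x \<longleftrightarrow> set_integrable lborel (T_domain x) (T_integrand K y x)"

definition T_op ::
  "(real \<Rightarrow> real \<Rightarrow> real \<Rightarrow> real) \<Rightarrow> (real \<Rightarrow> real) \<Rightarrow> real \<Rightarrow> real" where
  "T_op K y x = set_lebesgue_integral lborel (T_domain x) (T_integrand K y x)"

definition T_fixed_point ::
  "(real \<Rightarrow> real \<Rightarrow> real \<Rightarrow> real) \<Rightarrow> (real \<Rightarrow> real) \<Rightarrow> bool" where
  "T_fixed_point K y \<longleftrightarrow> (\<forall>x\<ge>0. T_op K y x = y x)"

text \<open>\<open>Ei_neg a x\<close> is the exponential integral \<open>Ei(-ax)\<close>, for \<open>a > 0\<close> and \<open>x > 0\<close>.\<close>

definition Ei_neg :: "real \<Rightarrow> real \<Rightarrow> real" where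
  "Ei_neg a x = - (LBINT t:{x..}. exp (- a * t) / t)"

definition eps_kernel :: "real \<Rightarrow> real \<Rightarrow> real \<Rightarrow> real \<Rightarrow> real" where
  "eps_kernel \<epsilon> u v x =
     1 - \<epsilon> / 3 + 2 * \<epsilon> * x / (u + v) - 2 * \<epsilon> * x\<^sup>2 / (u + v)\<^sup>2"

end

(* Along the lines u + v = s the integrand depends on s alone, and the segment of such (u, v) with
   u, v > 0 has measure s in the coordinates (u, s). Hence the double integral collapses to the
   integral of a^2 (1 - \<epsilon>/3 + 2 \<epsilon> x / s - 2 \<epsilon> x^2 / s^2) exp (- a s) over s \<ge> x; the last term is
   integrated by parts. At x = 0 only the factor 1 - \<epsilon>/3 of the kernel survives, so that
   (T y)(0) = (1 - \<epsilon>/3) y(0), which differs from y(0). *)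
theory Submission
  imports Defs
begin

section \<open>Pushforward of Lebesgue measure on the quadrant under addition\<close>

text \<open>The fibre over s > 0 is parametrised by u in (0, s), hence has length s; over s \<le> 0
  it is empty, in agreement with \<open>ennreal s\<close> = 0 there. An identity of measures lets
  integrability and the value of an integral be transported by the same fact.\<close>

lemma distr_plus_quadrant:
  "distr (density lborel (indicator ({0<..} \<times> {0<..}))) borel (\<lambda>(u, v). u + v)
   = density lborel (\<lambda>s::real. ennreal s)" (is "?M = ?N")
proof (rule measure_eqI)
  show "sets ?M = sets ?N" by simp
next
  fix A :: "real set" assume "A \<in> sets ?M"
  then have [measurable]: "A \<in> sets borel" by simp
  have Q[measurable]: "{0<..} \<times> {0<..} \<in> sets (borel :: (real \<times> real) measure)"
    by (simp add: borel_prod[symmetric])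
  have plus[measurable]: "(\<lambda>(u, v). u + v :: real) \<in> borel_measurable borel"
    by (intro borel_measurable_continuous_onI) (auto simp: split_beta intro!: continuous_intros)
  have "emeasure ?M A
      = (\<integral>\<^sup>+z. indicator A (case z of (u, v) \<Rightarrow> u + v) \<partial>density lborel (indicator ({0<..} \<times> {0<..})))"
    by (subst nn_integral_indicator[symmetric], simp, subst nn_integral_distr)
       (auto simp: plus)
  also have "\<dots> = (\<integral>\<^sup>+z. indicator ({0<..} \<times> {0<..}) z
                  * indicator A (case z of (u, v) \<Rightarrow> u + v) \<partial>lborel)"
    by (subst nn_integral_density) auto
  also have "\<dots> = (\<integral>\<^sup>+z. indicator {0<..} (fst z) * indicator {0<..} (snd z)
                  * indicator A (fst z + snd z) \<partial>(lborel \<Otimes>\<^sub>M lborel))"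
    unfolding lborel_prod by (intro nn_integral_cong) (auto split: split_indicator)
  also have "\<dots> = (\<integral>\<^sup>+u. \<integral>\<^sup>+v. indicator {0<..} u * indicator {0<..} v
                  * indicator A (u + v) \<partial>lborel \<partial>lborel)"
    by (subst lborel.nn_integral_fst[symmetric]) auto
  \<comment> \<open>For fixed u, the inner variable is translated from v to s = u + v. After the
    exchange of integrals that follows, the inner integral runs over the fibre of a fixed sum
    s.\<close>
  also have "\<dots> = (\<integral>\<^sup>+u. \<integral>\<^sup>+s. indicator {0<..} u * indicator {0<..} (s - u)
                  * indicator A s \<partial>lborel \<partial>lborel)"
  proof (rule nn_integral_cong)
    fix u :: real
    show "(\<integral>\<^sup>+v. indicator {0<..} u * indicator {0<..} v * indicator A (u + v) \<partial>lborel)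
        = (\<integral>\<^sup>+s. indicator {0<..} u * indicator {0<..} (s - u) * indicator A s \<partial>lborel)"
      by (subst (2) nn_integral_real_affine[where c=1 and t=u]) auto
  qed
  also have "\<dots> = (\<integral>\<^sup>+s. \<integral>\<^sup>+u. indicator {0<..} u * indicator {0<..} (s - u)
                  * indicator A s \<partial>lborel \<partial>lborel)"
    by (rule lborel_pair.Fubini') measurable
  also have "\<dots> = (\<integral>\<^sup>+s. ennreal s * indicator A s \<partial>lborel)"
  proof (rule nn_integral_cong)
    fix s :: real
    have "(\<integral>\<^sup>+u. indicator {0<..} u * indicator {0<..} (s - u) * indicator A s \<partial>lborel)
        = (\<integral>\<^sup>+u. indicator A s * indicator {0<..<s} u \<partial>lborel)"
      by (intro nn_integral_cong) (auto split: split_indicator)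
    also have "\<dots> = indicator A s * emeasure lborel {0<..<s}"
      by (rule nn_integral_cmult_indicator) simp
    \<comment> \<open>For s < 0 both sides vanish: the interval is empty and \<open>ennreal\<close>
      truncates s to 0.\<close>
    also have "\<dots> = ennreal s * indicator A s"
      by (cases "s \<ge> 0") (auto simp: ennreal_neg mult.commute)
    finally show "(\<integral>\<^sup>+u. indicator {0<..} u * indicator {0<..} (s - u) * indicator A s \<partial>lborel)
        = ennreal s * indicator A s" .
  qed
  also have "\<dots> = emeasure ?N A"
    by (subst emeasure_density) auto
  finally show "emeasure ?M A = emeasure ?N A" .
qed

text \<open>The condition x \<le> u + v involves the sum only, so it becomes the indicator of
  \<open>{x..}\<close> evaluated at u + v, and the factor s is the density of the pushforward
  measure. Integrability is an equivalence of its own because equality of Bochner integrals alone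
  says nothing about it.\<close>

lemma
  fixes g :: "real \<Rightarrow> real"
  assumes [measurable]: "g \<in> borel_measurable borel" and "x \<ge> 0"
  shows set_integrable_T_domain_plus:
      "set_integrable lborel (T_domain x) (\<lambda>(u, v). g (u + v))
        \<longleftrightarrow> set_integrable lborel {x..} (\<lambda>s. s * g s)" (is ?I)
    and set_integral_T_domain_plus:
      "set_lebesgue_integral lborel (T_domain x) (\<lambda>(u, v). g (u + v))
        = (LBINT s:{x..}. s * g s)" (is ?E)
proof -
  let ?h = "\<lambda>s. indicator {x..} s * g s"
  let ?Q = "density lborel (\<lambda>z. ennreal (indicator ({0<..} \<times> {0<..}) z)) :: (real \<times> real) measure"
  let ?p = "\<lambda>(u, v). u + v :: real"
  have Q[measurable]: "{0<..} \<times> {0<..} \<in> sets (borel :: (real \<times> real) measure)"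
    by (simp add: borel_prod[symmetric])
  \<comment> \<open>The density rules for Bochner integrals ask for a nonnegative real density.
    Replacing s by \<open>max 0 s\<close> leaves the measure unchanged, since \<open>ennreal\<close>
    sends negative reals to 0.\<close>
  have D: "distr ?Q borel ?p = density lborel (\<lambda>s. ennreal (max 0 s))"
    using distr_plus_quadrant by (simp add: ennreal_indicator ennreal_max_0)
  have plus: "?p \<in> borel_measurable borel"
    by (intro borel_measurable_continuous_onI) (auto simp: split_beta intro!: continuous_intros)
  then have p[measurable]: "?p \<in> measurable ?Q borel"
    by simp
  have eq1: "(\<lambda>z. indicator (T_domain x) z *\<^sub>R (case z of (u, v) \<Rightarrow> g (u + v)))
      = (\<lambda>z. indicator ({0<..} \<times> {0<..}) z *\<^sub>R ?h (?p z))"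
    by (auto simp: fun_eq_iff T_domain_def split: split_indicator)
  \<comment> \<open>Here x \<ge> 0 enters: on \<open>{x..}\<close> the truncated density is s
    itself.\<close>
  have eq2: "(\<lambda>s. indicator {x..} s *\<^sub>R (s * g s)) = (\<lambda>s. max 0 s *\<^sub>R ?h s)"
    using \<open>x \<ge> 0\<close> by (auto simp: fun_eq_iff split: split_indicator)
  have m: "(\<lambda>z. ?h (?p z)) \<in> borel_measurable lborel"
    using measurable_compose[OF plus, of ?h borel] by simp
  have "integrable lborel (\<lambda>z. indicator ({0<..} \<times> {0<..}) z *\<^sub>R ?h (?p z))
      \<longleftrightarrow> integrable ?Q (\<lambda>z. ?h (?p z))"
    by (rule integrable_density[symmetric]) (use m in auto)
  also have "\<dots> \<longleftrightarrow> integrable (distr ?Q borel ?p) ?h"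
    by (rule integrable_distr_eq[symmetric]) auto
  also have "\<dots> \<longleftrightarrow> integrable lborel (\<lambda>s. max 0 s *\<^sub>R ?h s)"
    unfolding D by (rule integrable_density) auto
  finally show ?I unfolding set_integrable_def eq1 eq2 .
  have "integral\<^sup>L lborel (\<lambda>z. indicator ({0<..} \<times> {0<..}) z *\<^sub>R ?h (?p z))
      = integral\<^sup>L ?Q (\<lambda>z. ?h (?p z))"
    by (rule integral_density[symmetric]) (use m in auto)
  also have "\<dots> = integral\<^sup>L (distr ?Q borel ?p) ?h"
    by (rule integral_distr[symmetric]) auto
  also have "\<dots> = integral\<^sup>L lborel (\<lambda>s. max 0 s *\<^sub>R ?h s)"
    unfolding D by (rule integral_density) auto
  finally show ?E unfolding set_lebesgue_integral_def eq1 eq2 .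
qed

section \<open>Exponential integrals over half-lines\<close>

text \<open>For a nonnegative integrand, convergence of an antiderivative at infinity already forces
  integrability: the integral is first computed in the extended nonnegative reals, where it always
  exists, and turns out to be finite.\<close>

lemma
  fixes f F :: "real \<Rightarrow> real"
  assumes "f \<in> borel_measurable borel"
    and "\<And>s. x \<le> s \<Longrightarrow> (F has_real_derivative f s) (at s)"
    and "\<And>s. x \<le> s \<Longrightarrow> 0 \<le> f s"
    and "(F \<longlongrightarrow> l) at_top"
  shows set_integrable_FTC_atLeast: "set_integrable lborel {x..} f" (is ?I)
    and set_integral_FTC_atLeast: "(LBINT s:{x..}. f s) = l - F x" (is ?E)
proof -
  have mono: "F x \<le> F s" if "x \<le> s" for s
    by (rule DERIV_nonneg_imp_nondecreasing[OF that]) (use assms in blast)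
  \<comment> \<open>This makes l - F x nonnegative, so that \<open>ennreal (l - F x)\<close> loses
    no information.\<close>
  have "F x \<le> l"
    by (rule tendsto_lowerbound[OF assms(4)])
       (use mono in \<open>auto simp: eventually_at_top_linorder intro!: exI[of _ x]\<close>)
  moreover have "(\<integral>\<^sup>+s. ennreal (indicator {x..} s *\<^sub>R f s) \<partial>lborel) = ennreal (l - F x)"
  proof -
    have "(\<integral>\<^sup>+s. ennreal (indicator {x..} s *\<^sub>R f s) \<partial>lborel)
        = (\<integral>\<^sup>+s. ennreal (f s) * indicator {x..} s \<partial>lborel)"
      by (intro nn_integral_cong) (simp split: split_indicator)
    also have "\<dots> = ennreal (l - F x)"
      by (intro nn_integral_FTC_atLeast assms)
    finally show ?thesis .
  qed
  ultimately have "has_bochner_integral lborel (\<lambda>s. indicator {x..} s *\<^sub>R f s) (l - F x)"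
    using assms by (intro has_bochner_integral_nn_integral) (auto split: split_indicator)
  then show ?I ?E
    by (auto simp: set_integrable_def set_lebesgue_integral_def has_bochner_integral_iff)
qed

lemma tendsto_exp_minus_mult_at_top:
  fixes a :: real
  assumes "a > 0"
  shows "((\<lambda>s. exp (- a * s)) \<longlongrightarrow> 0) at_top"
proof -
  have "filterlim (\<lambda>s. - a * s) at_bot at_top"
    using assms by (intro filterlim_tendsto_neg_mult_at_bot[OF tendsto_const] filterlim_ident) auto
  then show ?thesis by (rule filterlim_compose[OF exp_at_bot])
qed

lemma
  fixes a :: real
  assumes "a > 0"
  shows set_integrable_exp_minus: "set_integrable lborel {x..} (\<lambda>s. exp (- a * s))"
    and set_integral_exp_minus: "(LBINT s:{x..}. exp (- a * s)) = exp (- a * x) / a"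
proof -
  have D: "((\<lambda>s. - exp (- a * s) / a) has_real_derivative exp (- a * s)) (at s)" for s
    using assms by (auto intro!: derivative_eq_intros)
  have L: "((\<lambda>s. - exp (- a * s) / a) \<longlongrightarrow> 0) at_top"
    using tendsto_divide[OF tendsto_minus[OF tendsto_exp_minus_mult_at_top[OF assms]] tendsto_const, of a]
      assms by simp
  show "set_integrable lborel {x..} (\<lambda>s. exp (- a * s))"
    by (rule set_integrable_FTC_atLeast[OF _ D _ L]) auto
  show "(LBINT s:{x..}. exp (- a * s)) = exp (- a * x) / a"
    by (subst set_integral_FTC_atLeast[OF _ D _ L]) auto
qed

lemma set_integrable_bounded_mult_exp:
  fixes a :: real and w :: "real \<Rightarrow> real"
  assumes "a > 0" and [measurable]: "w \<in> borel_measurable borel"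
    and "\<And>s. x \<le> s \<Longrightarrow> \<bar>w s\<bar> \<le> C"
  shows "set_integrable lborel {x..} (\<lambda>s. w s * exp (- a * s))"
proof (rule set_integrable_bound)
  show "set_integrable lborel {x..} (\<lambda>s. C * exp (- a * s))"
    using set_integrable_exp_minus[OF assms(1)] by simp
  show "set_borel_measurable lborel {x..} (\<lambda>s. w s * exp (- a * s))"
    by (simp add: set_borel_measurable_def)
  show "AE s in lborel. s \<in> {x..} \<longrightarrow> norm (w s * exp (- a * s)) \<le> norm (C * exp (- a * s))"
  proof (intro AE_I2 impI)
    fix s assume "s \<in> {x..}"
    \<comment> \<open>No sign is assumed for C, and the norm of the dominating function contains
      \<bar>C\<bar>.\<close>
    then have "\<bar>w s\<bar> \<le> \<bar>C\<bar>" using assms(3)[of s] by auto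
    then show "norm (w s * exp (- a * s)) \<le> norm (C * exp (- a * s))"
      by (simp add: abs_mult)
  qed
qed

lemma
  fixes a :: real
  assumes "a > 0" "x > 0"
  shows set_integrable_exp_minus_over: "set_integrable lborel {x..} (\<lambda>s. exp (- a * s) / s)"
    and set_integrable_exp_minus_over_square:
      "set_integrable lborel {x..} (\<lambda>s. exp (- a * s) / s\<^sup>2)"
    and set_integral_exp_minus_over: "(LBINT s:{x..}. exp (- a * s) / s) = - Ei_neg a x"
    and set_integral_exp_minus_over_square:
      "(LBINT s:{x..}. exp (- a * s) / s\<^sup>2) = exp (- a * x) / x + a * Ei_neg a x"
proof -
  \<comment> \<open>Integration by parts in disguise: \<open>?f\<close> is the derivative of -exp
    (-as) / s. It is nonnegative, so its integral follows from the antiderivative, and the integral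
    with 1/s^2 is obtained by subtracting the one with 1/s.\<close>
  let ?f = "\<lambda>s. exp (- a * s) / s\<^sup>2 + a * (exp (- a * s) / s)"
  \<comment> \<open>Since x > 0, the weights 1/s and 1/s^2 are largest on \<open>{x..}\<close> at s
    = x, which gives the two constants C.\<close>
  have "set_integrable lborel {x..} (\<lambda>s. (1 / s) * exp (- a * s))"
    using assms by (intro set_integrable_bounded_mult_exp[where C = "1 / x"])
                   (auto intro: divide_left_mono)
  then show I1: "set_integrable lborel {x..} (\<lambda>s. exp (- a * s) / s)" by simp
  have "set_integrable lborel {x..} (\<lambda>s. (1 / s\<^sup>2) * exp (- a * s))"
    using assms by (intro set_integrable_bounded_mult_exp[where C = "1 / x\<^sup>2"])
                   (auto intro!: divide_left_mono power_mono)
  then show I2: "set_integrable lborel {x..} (\<lambda>s. exp (- a * s) / s\<^sup>2)" by simp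
  show E1: "(LBINT s:{x..}. exp (- a * s) / s) = - Ei_neg a x"
    by (simp add: Ei_neg_def)
  have D: "((\<lambda>s. - exp (- a * s) / s) has_real_derivative ?f s) (at s)" if "x \<le> s" for s
    using assms that
    by (auto intro!: derivative_eq_intros simp: field_simps power2_eq_square)
  have L: "((\<lambda>s. - exp (- a * s) / s) \<longlongrightarrow> 0) at_top"
    by (rule real_tendsto_divide_at_top[OF tendsto_minus[OF tendsto_exp_minus_mult_at_top[OF assms(1)]]
          filterlim_ident])
  have "(LBINT s:{x..}. ?f s) = exp (- a * x) / x"
    by (subst set_integral_FTC_atLeast[OF _ D _ L]) (use assms in auto)
  moreover have "(LBINT s:{x..}. ?f s)
      = (LBINT s:{x..}. exp (- a * s) / s\<^sup>2) + a * (LBINT s:{x..}. exp (- a * s) / s)"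
    by (simp only: set_integral_add(2)[OF I2 set_integrable_mult_right[OF I1]] set_integral_mult_right)
  ultimately show "(LBINT s:{x..}. exp (- a * s) / s\<^sup>2) = exp (- a * x) / x + a * Ei_neg a x"
    unfolding E1 by simp
qed

section \<open>The operator applied to an exponential\<close>

text \<open>The product y(u) y(v) = a^2 exp (-a(u + v)) and the kernel depend on u + v only, and the
  factor 1/(u + v) cancels the density s. The range x \<ge> 0 includes 0, where the fixed point
  equation is tested later.\<close>

lemma
  fixes \<epsilon> a :: real and y :: "real \<Rightarrow> real"
  assumes a: "a > 0" and y: "\<And>x. x \<ge> 0 \<Longrightarrow> y x = a * exp (- a * x)" and x: "x \<ge> 0"
  shows T_defined_eps_kernel_exp: "T_defined (eps_kernel \<epsilon>) y x" (is ?I)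
    and T_op_eps_kernel_exp: "T_op (eps_kernel \<epsilon>) y x
      = (LBINT s:{x..}. a\<^sup>2 * (1 - \<epsilon> / 3 + 2 * \<epsilon> * x / s - 2 * \<epsilon> * x\<^sup>2 / s\<^sup>2) * exp (- a * s))"
      (is ?E)
proof -
  let ?w = "\<lambda>s. a\<^sup>2 * (1 - \<epsilon> / 3 + 2 * \<epsilon> * x / s - 2 * \<epsilon> * x\<^sup>2 / s\<^sup>2)"
  let ?g = "\<lambda>s. ?w s * exp (- a * s) / s"
  have D: "T_domain x \<in> sets (lborel :: (real \<times> real) measure)"
  proof -
    have "T_domain x = {z. 0 < fst z} \<inter> {z. 0 < snd z} \<inter> {z. x \<le> fst z + snd z}"
      by (auto simp: T_domain_def)
    moreover have "\<dots> \<in> sets borel"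
      by (intro sets.Int borel_open borel_closed open_Collect_less closed_Collect_le
            continuous_intros)
    ultimately show ?thesis by simp
  qed
  have cong: "T_integrand (eps_kernel \<epsilon>) y x z = (case z of (u, v) \<Rightarrow> ?g (u + v))"
    if "z \<in> T_domain x" for z
  proof (cases z)
    case (Pair u v)
    then have "y u * y v = a\<^sup>2 * exp (- a * (u + v))"
      using that y[of u] y[of v]
      by (simp add: T_domain_def power2_eq_square distrib_left exp_diff exp_minus field_simps exp_add)
    then show ?thesis
      by (simp add: Pair T_integrand_def eps_kernel_def)
  qed
  \<comment> \<open>the two functions can differ at \<open>s = 0\<close>, which lies in the domain when \<open>x = 0\<close>\<close>
  have AE: "AE s in lborel. s \<in> {x..} \<longrightarrow> s * ?g s = ?w s * exp (- a * s)"
    using AE_lborel_singleton[of 0] by eventually_elim simp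
  have gm[measurable]: "?g \<in> borel_measurable borel" by measurable
  have bound: "\<bar>?w s\<bar> \<le> a\<^sup>2 * (\<bar>1 - \<epsilon> / 3\<bar> + 2 * \<bar>\<epsilon>\<bar> + 2 * \<bar>\<epsilon>\<bar>)" if "x \<le> s" for s
  proof -
    \<comment> \<open>In terms of r = x/s the weight is a quadratic polynomial with r in [0, 1], so
      its bound is uniform in s and survives x = 0. For x = s = 0, division by zero gives r =
      0.\<close>
    define r where "r = x / s"
    have r: "0 \<le> r" "r \<le> 1" using x that by (auto simp: r_def divide_le_eq_1)
    have "\<bar>1 - \<epsilon> / 3 + 2 * \<epsilon> * r - 2 * \<epsilon> * r\<^sup>2\<bar>
        \<le> \<bar>1 - \<epsilon> / 3\<bar> + \<bar>2 * \<epsilon> * r\<bar> + \<bar>2 * \<epsilon> * r\<^sup>2\<bar>" by linarith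
    also have "\<dots> \<le> \<bar>1 - \<epsilon> / 3\<bar> + 2 * \<bar>\<epsilon>\<bar> + 2 * \<bar>\<epsilon>\<bar>"
      using r by (intro add_mono) (auto simp: abs_mult mult_left_le power_le_one)
    finally have "a\<^sup>2 * \<bar>1 - \<epsilon> / 3 + 2 * \<epsilon> * r - 2 * \<epsilon> * r\<^sup>2\<bar>
        \<le> a\<^sup>2 * (\<bar>1 - \<epsilon> / 3\<bar> + 2 * \<bar>\<epsilon>\<bar> + 2 * \<bar>\<epsilon>\<bar>)"
      by (rule mult_left_mono) simp
    then show ?thesis by (simp add: r_def abs_mult power_divide)
  qed
  have "set_integrable lborel {x..} (\<lambda>s. ?w s * exp (- a * s))"
    by (rule set_integrable_bounded_mult_exp[OF a _ bound]) measurable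
  then have "set_integrable lborel {x..} (\<lambda>s. s * ?g s)"
    by (subst set_integrable_cong_AE[OF _ _ AE])
       (auto simp: set_borel_measurable_def)
  then have "set_integrable lborel (T_domain x) (\<lambda>(u, v). ?g (u + v))"
    by (subst set_integrable_T_domain_plus[OF gm x])
  then show ?I
    unfolding T_defined_def by (subst set_integrable_cong[OF refl refl cong])
  have "T_op (eps_kernel \<epsilon>) y x = set_lebesgue_integral lborel (T_domain x) (\<lambda>(u, v). ?g (u + v))"
    unfolding T_op_def using cong D by (intro set_lebesgue_integral_cong) auto
  also have "\<dots> = (LBINT s:{x..}. s * ?g s)"
    by (rule set_integral_T_domain_plus[OF gm x])
  also have "\<dots> = (LBINT s:{x..}. ?w s * exp (- a * s))"
    by (rule set_lebesgue_integral_cong_AE[OF _ _ _ AE]) auto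
  finally show ?E .
qed

text \<open>The integral is split by powers of 1/s into integrals already evaluated. This requires x
  > 0: over \<open>{0..}\<close> the integrals with 1/s and 1/s^2 diverge separately.\<close>

lemma T_op_eps_kernel_exp_closed_form:
  fixes \<epsilon> a :: real and y :: "real \<Rightarrow> real"
  assumes a: "a > 0" and y: "\<And>x. x \<ge> 0 \<Longrightarrow> y x = a * exp (- a * x)" and x: "x > 0"
  shows "T_op (eps_kernel \<epsilon>) y x = (1 - \<epsilon> / 3) * a * exp (- a * x)
    - 2 * \<epsilon> * x * a\<^sup>2 * Ei_neg a x
    - 2 * \<epsilon> * x\<^sup>2 * a\<^sup>2 * (exp (- a * x) / x + a * Ei_neg a x)"
proof -
  let ?e = "\<lambda>s. exp (- a * s)"
  let ?A = "a\<^sup>2 * (1 - \<epsilon> / 3)" and ?B = "2 * \<epsilon> * x * a\<^sup>2" and ?C = "2 * \<epsilon> * x\<^sup>2 * a\<^sup>2"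
  note I = set_integrable_exp_minus[OF a, of x]
    set_integrable_exp_minus_over[OF a x] set_integrable_exp_minus_over_square[OF a x]
  have "T_op (eps_kernel \<epsilon>) y x
      = (LBINT s:{x..}. a\<^sup>2 * (1 - \<epsilon> / 3 + 2 * \<epsilon> * x / s - 2 * \<epsilon> * x\<^sup>2 / s\<^sup>2) * ?e s)"
    using x by (intro T_op_eps_kernel_exp[OF a] y) auto
  also have "\<dots> = (LBINT s:{x..}. ?A * ?e s + ?B * (?e s / s) - ?C * (?e s / s\<^sup>2))"
    by (rule arg_cong[where f = "set_lebesgue_integral lborel {x..}"])
       (simp add: fun_eq_iff ring_distribs mult_ac)
  also have "\<dots> = (LBINT s:{x..}. ?A * ?e s + ?B * (?e s / s)) - (LBINT s:{x..}. ?C * (?e s / s\<^sup>2))"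
    by (intro set_integral_diff(2) set_integral_add(1) set_integrable_mult_right I)
  also have "(LBINT s:{x..}. ?A * ?e s + ?B * (?e s / s))
      = (LBINT s:{x..}. ?A * ?e s) + (LBINT s:{x..}. ?B * (?e s / s))"
    by (intro set_integral_add(2) set_integrable_mult_right I)
  also have "(LBINT s:{x..}. ?A * ?e s) = ?A * (?e x / a)"
    by (simp only: set_integral_mult_right set_integral_exp_minus[OF a])
  also have "(LBINT s:{x..}. ?B * (?e s / s)) = ?B * - Ei_neg a x"
    by (simp only: set_integral_mult_right set_integral_exp_minus_over[OF a x])
  also have "(LBINT s:{x..}. ?C * (?e s / s\<^sup>2)) = ?C * (?e x / x + a * Ei_neg a x)"
    by (simp only: set_integral_mult_right set_integral_exp_minus_over_square[OF a x])
  also have "?A * (?e x / a) = (1 - \<epsilon> / 3) * a * ?e x"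
    using a by (simp add: power2_eq_square)
  finally show ?thesis
    by simp
qed

text \<open>\<open>T_fixed_point\<close> quantifies over all x \<ge> 0, so one bad point is enough.
  At x = 0 the integral formula is elementary and no estimate of the exponential integral arises;
  the two values differ by a \<epsilon> / 3.\<close>

lemma not_T_fixed_point_eps_kernel_exp:
  fixes \<epsilon> a :: real and y :: "real \<Rightarrow> real"
  assumes a: "a > 0" and y: "\<And>x. x \<ge> 0 \<Longrightarrow> y x = a * exp (- a * x)" and "\<epsilon> \<noteq> 0"
  shows "\<not> T_fixed_point (eps_kernel \<epsilon>) y"
proof -
  have "T_op (eps_kernel \<epsilon>) y 0 = (LBINT s:{0..}. a\<^sup>2 * (1 - \<epsilon> / 3) * exp (- a * s))"
    using T_op_eps_kernel_exp[of a y 0 \<epsilon>] assms by simp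
  also have "\<dots> = a\<^sup>2 * (1 - \<epsilon> / 3) * (1 / a)"
    using set_integral_exp_minus[OF a, of 0] by (simp only: set_integral_mult_right) simp
  also have "\<dots> = (1 - \<epsilon> / 3) * a"
    using a by (simp add: power2_eq_square)
  also have "\<dots> \<noteq> y 0"
    using assms by simp
  finally show "\<not> T_fixed_point (eps_kernel \<epsilon>) y"
    by (auto simp: T_fixed_point_def)
qed

theorem mainTheorem2:
  fixes \<epsilon> a :: real and y :: "real \<Rightarrow> real"
  assumes "\<epsilon> \<noteq> 0" and "a > 0"
    and "\<And>x. x \<ge> 0 \<Longrightarrow> y x = a * exp (- a * x)"
  shows "(\<forall>x\<ge>0. T_defined (eps_kernel \<epsilon>) y x) \<and>
         (\<forall>x>0. T_op (eps_kernel \<epsilon>) y x =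
            (1 - \<epsilon> / 3) * a * exp (- a * x)
            - 2 * \<epsilon> * x * a\<^sup>2 * Ei_neg a x
            - 2 * \<epsilon> * x\<^sup>2 * a\<^sup>2 * (exp (- a * x) / x + a * Ei_neg a x)) \<and>
         \<not> T_fixed_point (eps_kernel \<epsilon>) y"
  using T_defined_eps_kernel_exp[OF assms(2), of y _ \<epsilon>]
    T_op_eps_kernel_exp_closed_form[OF assms(2), of y _ \<epsilon>]
    not_T_fixed_point_eps_kernel_exp[OF assms(2), of y \<epsilon>] assms(1,3)
  by auto

end
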